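(* For every integer $k\ge 0$, the number of subsets $F\subseteq[0,k]$ with $0\in F$ and $[0,k]\subseteq F+F$ equals $A^{\sigma\prime}_{2k+1}$. Moreover, as $k\to\infty$ this number is asymptotically equal to $\gamma^\sigma_\infty 2^k$, where $\gamma^\sigma_\infty=\lim_{g\to\infty}\gamma^\sigma_g$.
   Context: All intervals are intervals of integers; $F+F=\{a+b: a,b\in F\}$. For a positive integer $n$ and a subset $M\subseteq(0,n)$ put $M_+=\{m\in M: n-m\in M\}$, $M_-=\{x\in(0,n): x\notin M\text{ and }n-x\notin M\}$, $M^*=\{x\in(0,n): n-x\notin M\}$. The subset $M\subseteq (0,n)$ is $\sigma$-admissible if $M_-=\emptyset$ and for each $x\in M$ there is $y\in M^*$ with $x+y<n$ and $x+y\notin M$. $A^{\sigma\prime}_n$ denotes the number of $\sigma$-admissible subsets $M\subseteq(0,n)$ for which $M_+$ has at most one element. A numerical set is a cofinite subset $S\subseteq\mathbb N=\{0,1,2,\dots\}$ containing $0$; for $S\neq\mathbb N$ its Frobenius number is $\max(\mathbb N-S)$; its atom monoid is $A(S)=\{n\in\mathbb Z: n+S\subseteq S\}$. A numerical set $S$ with Frobenius number $g$ is symmetric if for every integer $x$: $x\in S\iff g-x\notin S$; if $g$ is even, it is pseudosymmetric if $g/2\notin S$ and for every integer $x\ne g/2$: $x\in S\iff g-x\notin S$. For $g\ge1$, $\mathcal S^\sigma(g)$ is the set of symmetric (if $g$ is odd) or pseudosymmetric (if $g$ is even) numerical sets with Frobenius number $g$, $\mathcal G^\sigma(g)=\{S\in\mathcal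 S^\sigma(g): A(S)=\{0\}\cup(g,\infty)\}$, and $\gamma^\sigma_g=|\mathcal G^\sigma(g)|/2^{\lfloor(g-1)/2\rfloor}$; the limit $\gamma^\sigma_\infty$ exists and lies strictly between $0$ and $1$. *)

theory Defs
  imports
    Complex_Main
    "HOL-Library.Set_Algebras"
    "HOL-Library.Landau_Symbols"
begin

text \<open>All sets of numbers are sets of integers; the natural numbers appear as
  \<^term>\<open>{0..} :: int set\<close>. The sumset \<open>F + F\<close> is the one of
  \<^theory>\<open>HOL-Library.Set_Algebras\<close>.\<close>

definition M_plus :: "int \<Rightarrow> int set \<Rightarrow> int set" where
  "M_plus n M = {m \<in> M. n - m \<in> M}"

definition M_minus :: "int \<Rightarrow> int set \<Rightarrow> int set" where
  "M_minus n M = {x \<in> {0<..<n}. x \<notin> M \<and> n - x \<notin> M}"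

definition M_star :: "int \<Rightarrow> int set \<Rightarrow> int set" where
  "M_star n M = {x \<in> {0<..<n}. n - x \<notin> M}"

definition sigma_admissible :: "int \<Rightarrow> int set \<Rightarrow> bool" where
  "sigma_admissible n M \<longleftrightarrow>
     M \<subseteq> {0<..<n} \<and> M_minus n M = {} \<and>
     (\<forall>x\<in>M. \<exists>y\<in>M_star n M. x + y < n \<and> x + y \<notin> M)"

definition A_sigma' :: "int \<Rightarrow> nat" where
  "A_sigma' n = card {M. sigma_admissible n M \<and> card (M_plus n M) \<le> 1}"

definition numerical_set :: "int set \<Rightarrow> bool" where
  "numerical_set S \<longleftrightarrow> S \<subseteq> {0..} \<and> finite ({0..} - S) \<and> 0 \<in> S"

text \<open>Only meaningful for \<^term>\<open>S \<noteq> {0..}\<close>; this is required wherever it is used.\<close>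

definition frobenius_number :: "int set \<Rightarrow> int" where
  "frobenius_number S = Max ({0..} - S)"

definition atom_monoid :: "int set \<Rightarrow> int set" where
  "atom_monoid S = {n. (+) n ` S \<subseteq> S}"

definition symmetric :: "int set \<Rightarrow> bool" where
  "symmetric S \<longleftrightarrow>
     numerical_set S \<and> S \<noteq> {0..} \<and>
     (\<forall>x. x \<in> S \<longleftrightarrow> frobenius_number S - x \<notin> S)"

definition pseudosymmetric :: "int set \<Rightarrow> bool" where
  "pseudosymmetric S \<longleftrightarrow>
     numerical_set S \<and> S \<noteq> {0..} \<and> even (frobenius_number S) \<and>
     frobenius_number S div 2 \<notin> S \<and>
     (\<forall>x. x \<noteq> frobenius_number S div 2 \<longrightarrow> (x \<in> S \<longleftrightarrow> frobenius_number S - x \<notin> S))"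

definition S_sigma :: "int \<Rightarrow> int set set" where
  "S_sigma g = {S. numerical_set S \<and> S \<noteq> {0..} \<and> frobenius_number S = g \<and>
                   (if odd g then symmetric S else pseudosymmetric S)}"

definition G_sigma :: "int \<Rightarrow> int set set" where
  "G_sigma g = {S \<in> S_sigma g. atom_monoid S = {0} \<union> {g<..}}"

text \<open>Intended for \<open>g \<ge> 1\<close>, where the truncated \<open>g - 1\<close> is the true difference;
  the value at \<open>0\<close> does not affect the limit.\<close>

definition gamma_sigma :: "nat \<Rightarrow> real" where
  "gamma_sigma g = real (card (G_sigma (int g))) / 2 ^ ((g - 1) div 2)"

definition gamma_sigma_inf :: real where
  "gamma_sigma_inf = lim gamma_sigma"

definition bases :: "nat \<Rightarrow> int set set" where
  "bases k = {F. F \<subseteq> {0..int k} \<and> 0 \<in> F \<and> {0..int k} \<subseteq> F + F}"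

end

theory Submission
  imports Defs "HOL-Library.Disjoint_Sets"
begin

text \<open>Let \<open>k = (g - 1) div 2\<close>. A (pseudo)symmetric set \<open>S\<close> with Frobenius number \<open>g\<close> is
  determined by the arbitrary set \<open>F = S \<inter> [0,k]\<close> containing \<open>0\<close>, and by duality a number \<open>x \<le> k\<close>
  lies outside \<open>F + F\<close> iff \<open>g - x\<close> belongs to the atom monoid. If the atom monoid contains any
  \<open>d\<close> with \<open>0 < d < g\<close>, it contains all multiples of \<open>d\<close>, in particular \<open>g - g mod d\<close>, and
  \<open>g mod d \<le> k\<close>. Hence \<open>F\<close> is a basis iff the atom monoid is trivial, so that
  \<open>\<gamma>\<close> at \<open>2k+1\<close> and at \<open>2k+2\<close> is exactly the number of bases divided by \<open>2^k\<close>. This quotient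
  is decreasing in \<open>k\<close>, and it is bounded below by a union bound over the random sets
  containing \<open>{0..3}\<close>.\<close>

section \<open>Self-dual sets and bases\<close>

text \<open>The traces on \<open>[0,g]\<close> of the symmetric and pseudosymmetric sets with Frobenius number \<open>g\<close>;
  the conjunct \<open>2 * x \<noteq> g\<close> removes the midpoint when \<open>g\<close> is even.\<close>

definition selfdual_sets :: "int \<Rightarrow> int set set" where
  "selfdual_sets g = {T. T \<subseteq> {0..g} \<and> 0 \<in> T \<and> (\<forall>x\<in>{0..g}. x \<in> T \<longleftrightarrow> g - x \<notin> T \<and> 2 * x \<noteq> g)}"

text \<open>This says that no \<open>d\<close> with \<open>0 < d < g\<close> lies in the atom monoid
  of \<open>T \<union> {g<..}\<close>. Sums beyond \<open>g\<close> always stay in that set, hence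
  the restriction to \<open>d + t \<le> g\<close>.\<close>

definition atom_free :: "int \<Rightarrow> int set \<Rightarrow> bool" where
  "atom_free g T \<longleftrightarrow> (\<forall>d\<in>{0<..<g}. \<exists>t\<in>T. d + t \<le> g \<and> d + t \<notin> T)"

lemma selfdual_setsD:
  assumes "T \<in> selfdual_sets g"
  shows "0 \<in> T" "T \<subseteq> {0..g}"
  using assms unfolding selfdual_sets_def by blast+

lemma selfdual_sets_iff:
  assumes "T \<in> selfdual_sets g" "0 \<le> x" "x \<le> g"
  shows "x \<in> T \<longleftrightarrow> g - x \<notin> T \<and> 2 * x \<noteq> g"
proof -
  have "\<forall>x\<in>{0..g}. x \<in> T \<longleftrightarrow> g - x \<notin> T \<and> 2 * x \<noteq> g"
    using assms(1) unfolding selfdual_sets_def by blast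
  from bspec[OF this, of x] show ?thesis
    using assms(2,3) by simp
qed

lemma Frobenius_notin_selfdual:
  assumes "T \<in> selfdual_sets g" "0 \<le> g"
  shows "g \<notin> T"
  using selfdual_sets_iff[OF assms(1), of g] selfdual_setsD(1)[OF assms(1)] assms(2) by simp

lemma atom_multiple:
  fixes g d :: int
  assumes d: "0 < d" and atom: "\<And>t. t \<in> T \<Longrightarrow> d + t \<le> g \<Longrightarrow> d + t \<in> T"
    and t: "t \<in> T" "int j * d + t \<le> g"
  shows "int j * d + t \<in> T"
  using t(2)
proof (induction j)
  case (Suc j)
  have "int j * d + t \<in> T"
    using Suc d by (simp add: algebra_simps)
  from atom[OF this] Suc.prems show ?case
    by (simp add: algebra_simps)
qed (use t in auto)

text \<open>In both cases for \<open>g\<close>, \<open>k\<close> is the largest integer strictly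
  below \<open>g/2\<close>, so a single statement serves both parities.\<close>

lemma atom_free_iff_basis:
  assumes T: "T \<in> selfdual_sets g" and g: "g = 2 * int k + 1 \<or> g = 2 * int k + 2"
  shows "atom_free g T \<longleftrightarrow> T \<inter> {0..int k} \<in> bases k"
proof
  assume free: "atom_free g T"
  note T0 = selfdual_setsD[OF T]
  have "x \<in> (T \<inter> {0..int k}) + (T \<inter> {0..int k})" if x: "x \<in> {0..int k}" for x
  proof (cases "x = 0")
    case True
    have "0 + 0 \<in> (T \<inter> {0..int k}) + (T \<inter> {0..int k})"
      by (intro set_plus_intro) (use T0 in auto)
    then show ?thesis using True by simp
  next
    case False
    then have "g - x \<in> {0<..<g}"
      using x g by auto
    then obtain t where t: "t \<in> T" "g - x + t \<le> g" "g - x + t \<notin> T"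
      using free unfolding atom_free_def by blast
    have "0 \<le> t" using t T0 by auto
    \<comment> \<open>This is the reflection of the gap \<open>g - x + t\<close>. It is not the
      midpoint because \<open>x - t \<le> k\<close>, so duality puts it in \<open>T\<close>.\<close>
    have "x - t \<in> T"
      using selfdual_sets_iff[OF T, of "x - t"] t x g \<open>0 \<le> t\<close>
      by (auto simp: algebra_simps)
    then have "t + (x - t) \<in> (T \<inter> {0..int k}) + (T \<inter> {0..int k})"
      by (intro set_plus_intro) (use t x \<open>0 \<le> t\<close> in auto)
    then show ?thesis by simp
  qed
  then show "T \<inter> {0..int k} \<in> bases k"
    using T0 by (auto simp: bases_def)
next
  assume basis: "T \<inter> {0..int k} \<in> bases k"
  note T0 = selfdual_setsD[OF T]
  show "atom_free g T"
  proof (rule ccontr)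
    assume "\<not> atom_free g T"
    then obtain d where d: "0 < d" "d < g"
      and atom: "\<And>t. t \<in> T \<Longrightarrow> d + t \<le> g \<Longrightarrow> d + t \<in> T"
      unfolding atom_free_def by auto
    define x where "x = g mod d"
    define j where "j = nat (g div d)"
    have x: "0 \<le> x" "x < d"
      using d by (auto simp: x_def)
    have "0 < g div d"
      using d by (simp add: pos_imp_zdiv_pos_iff)
    then have j: "int j = g div d"
      by (simp add: j_def)
    then have jd: "int j * d = g - x"
      by (simp add: x_def minus_mod_eq_div_mult)
    have "d \<le> int j * d"
      using \<open>0 < g div d\<close> d j by simp
    \<comment> \<open>From \<open>x < d \<le> int j * d = g - x\<close> the remainder is strictly
      below \<open>g/2\<close>, hence in the range covered by the basis.\<close>
    then have "x \<in> {0..int k}" "2 * x < g"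
      using x jd g by auto
    then obtain a b where ab: "a \<in> T" "b \<in> T" "0 \<le> a" "0 \<le> b" "x = a + b"
      using basis unfolding bases_def by (fastforce elim!: set_plus_elim)
    \<comment> \<open>Adding the multiple \<open>g - x\<close> of \<open>d\<close> to
      \<open>a\<close> gives \<open>g - b\<close>, so \<open>b\<close> and its reflection would both
      lie in \<open>T\<close>.\<close>
    have "int j * d + a \<in> T"
      by (rule atom_multiple[OF d(1) atom]) (use ab jd in auto)
    moreover have "int j * d + a = g - b"
      using ab jd by linarith
    ultimately have "g - b \<in> T" by simp
    with selfdual_sets_iff[OF T, of b] ab \<open>2 * x < g\<close> show False by auto
  qed
qed

text \<open>Truncation to \<open>[0,k]\<close> loses nothing: duality prescribes the upper half and
  excludes the midpoint.\<close>

lemma card_atom_free_selfdual: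
  assumes g: "g = 2 * int k + 1 \<or> g = 2 * int k + 2"
  shows "card {T \<in> selfdual_sets g. atom_free g T} = card (bases k)"
proof -
  \<comment> \<open>The inverse of truncation. The clause \<open>2 * y \<noteq> g\<close> matters
    only for \<open>g = 2 * int k + 2\<close>, where it removes \<open>k + 1\<close>.\<close>
  define ext where "ext F = F \<union> {y \<in> {int k<..g}. 2 * y \<noteq> g \<and> g - y \<notin> F}" for F
  have ext: "ext F \<in> selfdual_sets g \<and> ext F \<inter> {0..int k} = F" if "F \<in> bases k" for F
  proof -
    have F: "F \<subseteq> {0..int k}" "0 \<in> F"
      using that by (auto simp: bases_def)
    have lo: "x \<in> ext F \<longleftrightarrow> x \<in> F" if "x \<le> int k" for x
      using that by (auto simp: ext_def)
    have hi: "x \<in> ext F \<longleftrightarrow> x \<le> g \<and> 2 * x \<noteq> g \<and> g - x \<notin> F" if "int k < x" for x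
      using that F by (auto simp: ext_def)
    have "x \<in> ext F \<longleftrightarrow> g - x \<notin> ext F \<and> 2 * x \<noteq> g" if "x \<in> {0..g}" for x
    proof -
      consider "x \<le> int k" "int k < g - x" | "int k < x" "g - x \<le> int k" | "2 * x = g" "int k < x"
        using g by linarith
      then show ?thesis
      proof cases
        case 1
        then show ?thesis using lo[of x] hi[of "g - x"] that by auto
      next
        case 2
        then show ?thesis using lo[of "g - x"] hi[of x] that by auto
      next
        case 3
        then show ?thesis using hi[of x] by simp
      qed
    qed
    moreover have "ext F \<subseteq> {0..g}"
      using F g by (auto simp: ext_def)
    moreover have "0 \<in> ext F"
      using F(2) by (simp add: ext_def)
    ultimately have "ext F \<in> selfdual_sets g"
      unfolding selfdual_sets_def by blast
    moreover have "ext F \<inter> {0..int k} = F"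
      using F lo by auto
    ultimately show ?thesis ..
  qed
  have ext_inv: "ext (T \<inter> {0..int k}) = T" if T: "T \<in> selfdual_sets g" for T
  proof (rule set_eqI)
    fix y
    note sub = selfdual_setsD(2)[OF T]
    show "y \<in> ext (T \<inter> {0..int k}) \<longleftrightarrow> y \<in> T"
    proof (cases "int k < y \<and> y \<le> g")
      case True
      then have "0 \<le> g - y" "2 * y \<noteq> g \<Longrightarrow> g - y \<le> int k"
        using g by auto
      with True show ?thesis
        using selfdual_sets_iff[OF T, of y] unfolding ext_def by auto
    next
      case False
      then show ?thesis
        using sub unfolding ext_def by auto
    qed
  qed
  have "bij_betw (\<lambda>T. T \<inter> {0..int k}) {T \<in> selfdual_sets g. atom_free g T} (bases k)"
  proof (rule bij_betw_byWitness[where f' = ext])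
    show "(\<lambda>T. T \<inter> {0..int k}) ` {T \<in> selfdual_sets g. atom_free g T} \<subseteq> bases k"
      using atom_free_iff_basis[OF _ g] by blast
    show "ext ` bases k \<subseteq> {T \<in> selfdual_sets g. atom_free g T}"
    proof (rule image_subsetI)
      fix F assume "F \<in> bases k"
      with ext[OF this] atom_free_iff_basis[OF _ g, of "ext F"]
      show "ext F \<in> {T \<in> selfdual_sets g. atom_free g T}" by simp
    qed
  qed (use ext ext_inv in blast)+
  then show ?thesis by (rule bij_betw_same_card)
qed

section \<open>Admissible sets\<close>

text \<open>Duality makes \<open>M_star n M\<close> equal to \<open>M\<close> and empties
  \<open>M_plus\<close> and \<open>M_minus\<close>. What remains is to compare a condition on
  \<open>M\<close> with one on all of \<open>(0,n)\<close>.\<close>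

lemma sigma_admissible_iff_atom_free:
  fixes k :: nat
  defines "n \<equiv> 2 * int k + 1"
  assumes M: "insert 0 M \<in> selfdual_sets n" "0 \<notin> M"
  shows "sigma_admissible n M \<and> card (M_plus n M) \<le> 1 \<longleftrightarrow> atom_free n (insert 0 M)"
proof -
  have "n \<notin> insert 0 M"
    using Frobenius_notin_selfdual[OF M(1)] by (simp add: n_def)
  then have sub: "M \<subseteq> {0<..<n}"
    using selfdual_setsD(2)[OF M(1)] M(2) by (force simp: less_le)
  have dual: "x \<in> M \<longleftrightarrow> n - x \<notin> M" if "x \<in> {0<..<n}" for x
    using selfdual_sets_iff[OF M(1), of x] that by (auto simp: n_def) presburger
  have minus: "M_minus n M = {}" and plus: "M_plus n M = {}" and star: "M_star n M = M"
    using sub dual unfolding M_minus_def M_plus_def M_star_def by blast+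
  define witness where "witness d \<longleftrightarrow> (\<exists>t\<in>insert 0 M. d + t \<le> n \<and> d + t \<notin> insert 0 M)" for d
  have "(\<exists>y\<in>M. d + y < n \<and> d + y \<notin> M) \<longleftrightarrow> witness d" if d: "d \<in> M" for d
  proof -
    have "d + y \<le> n \<and> d + y \<notin> insert 0 M \<longleftrightarrow> d + y < n \<and> d + y \<notin> M" if y: "y \<in> M" for y
    proof -
      \<comment> \<open>The sum \<open>d + y = n\<close> is impossible, since \<open>d\<close> and
        \<open>n - d\<close> cannot both lie in \<open>M\<close>; so the bounds
        \<open>\<le> n\<close> and \<open>< n\<close> agree.\<close>
      have "0 < d" "0 < y" "d + y \<noteq> n"
        using dual[of d] d y sub by auto
      then show ?thesis by auto
    qed
    then show ?thesis
      using d by (simp add: witness_def cong: bex_cong)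
  qed
  then have "(\<forall>x\<in>M. \<exists>y\<in>M. x + y < n \<and> x + y \<notin> M) \<longleftrightarrow> (\<forall>x\<in>M. witness x)"
    by (rule ball_cong[OF refl])
  \<comment> \<open>For \<open>d\<close> outside \<open>M\<close> the choice \<open>t = 0\<close>
    works.\<close>
  moreover have "witness d" if "d \<in> {0<..<n} - M" for d
    using that by (auto simp: witness_def)
  then have "(\<forall>x\<in>M. witness x) \<longleftrightarrow> (\<forall>x\<in>{0<..<n}. witness x)"
    using sub by blast
  ultimately have "(\<forall>x\<in>M. \<exists>y\<in>M. x + y < n \<and> x + y \<notin> M) \<longleftrightarrow> atom_free n (insert 0 M)"
    unfolding atom_free_def witness_def by simp
  then show ?thesis
    using sub by (simp add: sigma_admissible_def minus plus star)
qed

text \<open>An empty \<open>M_minus\<close> gives at least one of \<open>x\<close> and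
  \<open>n - x\<close>; the bound on \<open>M_plus\<close> excludes having both.\<close>

lemma sigma_admissible_selfdual:
  fixes k :: nat
  defines "n \<equiv> 2 * int k + 1"
  assumes adm: "sigma_admissible n M" and card: "card (M_plus n M) \<le> 1"
  shows "insert 0 M \<in> selfdual_sets n"
proof -
  have sub: "M \<subseteq> {0<..<n}" and minus: "M_minus n M = {}"
    using adm by (auto simp: sigma_admissible_def)
  have fin: "finite (M_plus n M)"
    by (rule finite_subset[of _ "{0<..<n}"]) (use sub in \<open>auto simp: M_plus_def\<close>)
  text \<open>As \<open>n\<close> is odd, \<open>x \<mapsto> n - x\<close> has no fixed point on \<open>M\<^sub>+\<close>.\<close>
  have plus: "\<not> (x \<in> M \<and> n - x \<in> M)" for x
  proof
    assume "x \<in> M \<and> n - x \<in> M"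
    then have "{x, n - x} \<subseteq> M_plus n M"
      by (auto simp: M_plus_def)
    then have "card {x, n - x} \<le> 1"
      using card_mono[OF fin] card by (meson le_trans)
    moreover have "x \<noteq> n - x"
      unfolding n_def by presburger
    ultimately show False by simp
  qed
  have "x \<in> M \<or> n - x \<in> M" if "x \<in> {0<..<n}" for x
    using minus that by (auto simp: M_minus_def)
  moreover have "2 * x \<noteq> n" for x
    unfolding n_def by presburger
  ultimately have dual: "x \<in> M \<longleftrightarrow> n - x \<notin> M \<and> 2 * x \<noteq> n" if "x \<in> {0<..<n}" for x
    using plus that by blast
  have n: "0 < n" "n \<notin> M" "0 \<notin> M"
    using sub by (auto simp: n_def)
  have "x \<in> insert 0 M \<longleftrightarrow> n - x \<notin> insert 0 M \<and> 2 * x \<noteq> n" if "x \<in> {0..n}" for x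
  proof -
    consider "x = 0" | "x = n" | "x \<in> {0<..<n}"
      using \<open>x \<in> {0..n}\<close> by fastforce
    then show ?thesis
    proof cases
      case 3
      then have "x \<noteq> 0" "n - x \<noteq> 0" by auto
      with dual[OF 3] show ?thesis by blast
    qed (use n in auto)
  qed
  moreover have "insert 0 M \<subseteq> {0..n}"
    using sub n by auto
  ultimately show ?thesis
    unfolding selfdual_sets_def by blast
qed

lemma A_sigma'_eq_card_bases: "A_sigma' (2 * int k + 1) = card (bases k)"
proof -
  define n where "n = 2 * int k + 1"
  let ?A = "{M. sigma_admissible n M \<and> card (M_plus n M) \<le> 1}"
  have sd: "insert 0 M \<in> selfdual_sets n \<and> 0 \<notin> M \<and> atom_free n (insert 0 M)" if "M \<in> ?A" for M
  proof -
    have "insert 0 M \<in> selfdual_sets n" "0 \<notin> M"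
      using that sigma_admissible_selfdual[of k M] by (auto simp: n_def sigma_admissible_def)
    then show ?thesis
      using that sigma_admissible_iff_atom_free[of M k] by (auto simp: n_def)
  qed
  have "bij_betw (insert 0) ?A {T \<in> selfdual_sets n. atom_free n T}"
  proof (rule bij_betw_byWitness[where f' = "\<lambda>T. T - {0}"])
    show "(\<lambda>T. T - {0}) ` {T \<in> selfdual_sets n. atom_free n T} \<subseteq> ?A"
    proof safe
      fix T assume T: "T \<in> selfdual_sets n" "atom_free n T"
      then have "insert 0 (T - {0}) = T"
        using selfdual_setsD(1) by blast
      then show "sigma_admissible n (T - {0})" "card (M_plus n (T - {0})) \<le> 1"
        using T sigma_admissible_iff_atom_free[of "T - {0}" k] by (auto simp: n_def)
    qed
  qed (use sd selfdual_setsD(1) in \<open>auto simp: insert_absorb\<close>)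
  from bij_betw_same_card[OF this] have "card ?A = card (bases k)"
    using card_atom_free_selfdual[of n k] by (simp add: n_def)
  then show ?thesis
    by (simp add: A_sigma'_def n_def)
qed

section \<open>Numerical sets with trivial atom monoid\<close>

lemma frobenius_number_eq_iff:
  assumes "numerical_set S" "S \<noteq> {0..}"
  shows "frobenius_number S = g \<longleftrightarrow> 0 \<le> g \<and> g \<notin> S \<and> {g<..} \<subseteq> S"
proof -
  have "finite ({0..} - S)" "{0..} - S \<noteq> {}"
    using assms by (auto simp: numerical_set_def)
  from Max_eq_iff[OF this, of g]
  have "frobenius_number S = g \<longleftrightarrow> g \<in> {0..} - S \<and> (\<forall>a\<in>{0..} - S. a \<le> g)"
    unfolding frobenius_number_def .
  also have "\<dots> \<longleftrightarrow> 0 \<le> g \<and> g \<notin> S \<and> {g<..} \<subseteq> S"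
    by (auto simp: not_le[symmetric] subset_iff)
  finally show ?thesis .
qed

lemma S_sigma_trace:
  assumes S: "S \<in> S_sigma g" and g: "0 < g"
  shows "S \<inter> {0..g} \<in> selfdual_sets g" "S = (S \<inter> {0..g}) \<union> {g<..}"
proof -
  have num: "numerical_set S" "S \<noteq> {0..}" and frob: "frobenius_number S = g"
    using S by (auto simp: S_sigma_def)
  have gS: "g \<notin> S" "{g<..} \<subseteq> S" "0 \<in> S" "S \<subseteq> {0..}"
    using frobenius_number_eq_iff[OF num, of g] frob num(1) by (simp_all add: numerical_set_def)
  \<comment> \<open>One condition covers both parities: \<open>2 * x \<noteq> g\<close> is vacuous
    for odd \<open>g\<close> and encodes the missing midpoint for even \<open>g\<close>.\<close>
  have dual: "x \<in> S \<longleftrightarrow> g - x \<notin> S \<and> 2 * x \<noteq> g" for x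
  proof (cases "odd g")
    case True
    then have "symmetric S"
      using S by (simp add: S_sigma_def)
    then have "x \<in> S \<longleftrightarrow> g - x \<notin> S"
      unfolding symmetric_def frob by blast
    moreover have "2 * x \<noteq> g"
      using True by auto
    ultimately show ?thesis by blast
  next
    case False
    then have "pseudosymmetric S"
      using S by (simp add: S_sigma_def)
    then have "g div 2 \<notin> S" "x \<noteq> g div 2 \<Longrightarrow> x \<in> S \<longleftrightarrow> g - x \<notin> S"
      unfolding pseudosymmetric_def frob by blast+
    moreover have "2 * x = g \<longleftrightarrow> x = g div 2"
      using False by auto
    ultimately show ?thesis
      by (cases "x = g div 2") (simp, blast)
  qed
  have "x \<in> S \<inter> {0..g} \<longleftrightarrow> g - x \<notin> S \<inter> {0..g} \<and> 2 * x \<noteq> g" if "x \<in> {0..g}" for x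
  proof -
    have "g - x \<in> {0..g}" using that by auto
    with that dual[of x] show ?thesis by blast
  qed
  moreover have "0 \<in> S \<inter> {0..g}"
    using gS(3) g by simp
  ultimately show "S \<inter> {0..g} \<in> selfdual_sets g"
    unfolding selfdual_sets_def by blast
  show "S = (S \<inter> {0..g}) \<union> {g<..}"
    using gS by force
qed

lemma selfdual_Un_greaterThan_in_S_sigma:
  assumes T: "T \<in> selfdual_sets g" and g: "0 < g"
  shows "T \<union> {g<..} \<in> S_sigma g"
proof -
  let ?S = "T \<union> {g<..}"
  note T0 = selfdual_setsD[OF T]
  have gT: "g \<notin> T"
    using Frobenius_notin_selfdual[OF T] g by simp
  have "finite ({0..} - ?S)"
    by (rule finite_subset[of _ "{0..g}"]) auto
  then have num: "numerical_set ?S" and ne: "?S \<noteq> {0..}"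
    using T0 gT g by (auto simp: numerical_set_def)
  have frob: "frobenius_number ?S = g"
    using frobenius_number_eq_iff[OF num ne] gT g by auto
  \<comment> \<open>Outside \<open>[0,g]\<close> this holds because reflection swaps the negative
    integers, all absent, with those above \<open>g\<close>, all present.\<close>
  have dual: "x \<in> ?S \<longleftrightarrow> g - x \<notin> ?S \<and> 2 * x \<noteq> g" for x
    using selfdual_sets_iff[OF T, of x] T0 g by auto
  show ?thesis
  proof (cases "odd g")
    case True
    then have "2 * x \<noteq> g" for x by auto
    with dual have "symmetric ?S"
      unfolding symmetric_def frob using num ne by blast
    then show ?thesis
      using True num ne frob by (simp add: S_sigma_def)
  next
    case False
    then have "2 * x \<noteq> g \<longleftrightarrow> x \<noteq> g div 2" for x by auto
    with dual False have "pseudosymmetric ?S"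
      unfolding pseudosymmetric_def frob using num ne by blast
    then show ?thesis
      using False num ne frob by (simp add: S_sigma_def)
  qed
qed

text \<open>Only shifts in \<open>(0,g)\<close> depend on \<open>T\<close>: zero and everything
  above \<open>g\<close> always belong to the atom monoid, while negative shifts and
  \<open>g\<close> itself move \<open>0\<close> out of the set.\<close>

lemma atom_monoid_trivial_iff:
  assumes T: "T \<in> selfdual_sets g" and g: "0 < g"
  shows "atom_monoid (T \<union> {g<..}) = {0} \<union> {g<..} \<longleftrightarrow> atom_free g T"
proof -
  note T0 = selfdual_setsD[OF T]
  have gT: "g \<notin> T"
    using Frobenius_notin_selfdual[OF T] g by simp
  have mem: "n \<in> atom_monoid (T \<union> {g<..}) \<longleftrightarrow> (\<forall>s\<in>T \<union> {g<..}. n + s \<in> T \<union> {g<..})" for n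
    by (auto simp: atom_monoid_def)
  have inner: "n \<in> atom_monoid (T \<union> {g<..}) \<longleftrightarrow> (\<forall>t\<in>T. n + t \<le> g \<longrightarrow> n + t \<in> T)"
    if "0 < n" "n < g" for n
    unfolding mem using that T0 by fastforce
  have outer: "n \<in> atom_monoid (T \<union> {g<..}) \<longleftrightarrow> n \<in> {0} \<union> {g<..}" if "n \<notin> {0<..<g}" for n
  proof (cases "n = 0 \<or> g < n")
    case True
    then show ?thesis unfolding mem using T0 g by auto
  next
    case False
    then have "n < 0 \<or> n = g" using that by auto
    then have "n + 0 \<notin> T \<union> {g<..}" using T0 gT g by auto
    then show ?thesis unfolding mem using T0 False by blast
  qed
  have "atom_monoid (T \<union> {g<..}) = {0} \<union> {g<..} \<longleftrightarrow>
      (\<forall>n\<in>{0<..<g}. n \<notin> atom_monoid (T \<union> {g<..}))"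
    using outer by (auto simp: set_eq_iff)
  also have "\<dots> \<longleftrightarrow> atom_free g T"
    unfolding atom_free_def by (intro ball_cong refl) (auto simp: inner)
  finally show ?thesis .
qed

lemma card_G_sigma:
  assumes g: "g = 2 * int k + 1 \<or> g = 2 * int k + 2"
  shows "card (G_sigma g) = card (bases k)"
proof -
  have "0 < g" using g by auto
  have "bij_betw (\<lambda>S. S \<inter> {0..g}) (G_sigma g) {T \<in> selfdual_sets g. atom_free g T}"
  proof (rule bij_betw_byWitness[where f' = "\<lambda>T. T \<union> {g<..}"])
    show "\<forall>S\<in>G_sigma g. S \<inter> {0..g} \<union> {g<..} = S"
      using S_sigma_trace(2)[OF _ \<open>0 < g\<close>] by (auto simp: G_sigma_def)
    show "\<forall>T\<in>{T \<in> selfdual_sets g. atom_free g T}. (T \<union> {g<..}) \<inter> {0..g} = T"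
      using selfdual_setsD(2) by fastforce
    show "(\<lambda>S. S \<inter> {0..g}) ` G_sigma g \<subseteq> {T \<in> selfdual_sets g. atom_free g T}"
    proof (rule image_subsetI)
      fix S assume "S \<in> G_sigma g"
      then have S: "S \<in> S_sigma g" "atom_monoid S = {0} \<union> {g<..}"
        by (auto simp: G_sigma_def)
      note tr = S_sigma_trace[OF S(1) \<open>0 < g\<close>]
      show "S \<inter> {0..g} \<in> {T \<in> selfdual_sets g. atom_free g T}"
        using atom_monoid_trivial_iff[OF tr(1) \<open>0 < g\<close>] tr S(2) by simp
    qed
    show "(\<lambda>T. T \<union> {g<..}) ` {T \<in> selfdual_sets g. atom_free g T} \<subseteq> G_sigma g"
      using selfdual_Un_greaterThan_in_S_sigma[OF _ \<open>0 < g\<close>] atom_monoid_trivial_iff[OF _ \<open>0 < g\<close>]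
      by (auto simp: G_sigma_def)
  qed
  from bij_betw_same_card[OF this] show ?thesis
    using card_atom_free_selfdual[OF g] by simp
qed

lemma gamma_sigma_eq:
  assumes "1 \<le> g"
  shows "gamma_sigma g = real (card (bases ((g - 1) div 2))) / 2 ^ ((g - 1) div 2)"
proof -
  have "int g = 2 * int ((g - 1) div 2) + 1 \<or> int g = 2 * int ((g - 1) div 2) + 2"
    using assms by presburger
  from card_G_sigma[OF this] show ?thesis
    by (simp add: gamma_sigma_def)
qed

section \<open>The density of bases\<close>

lemma finite_bases: "finite (bases k)"
  by (rule finite_subset[of _ "Pow {0..int k}"]) (auto simp: bases_def)

text \<open>The summands are nonnegative, so a sum that is at most \<open>k\<close> uses no summand
  above \<open>k\<close>.\<close>

lemma bases_restrict:
  assumes "F \<in> bases (Suc k)"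
  shows "F \<inter> {0..int k} \<in> bases k"
proof -
  have F: "F \<subseteq> {0..int (Suc k)}" "0 \<in> F" "{0..int (Suc k)} \<subseteq> F + F"
    using assms by (auto simp: bases_def)
  have "x \<in> (F \<inter> {0..int k}) + (F \<inter> {0..int k})" if "x \<in> {0..int k}" for x
  proof -
    have "x \<in> F + F" using that F(3) by auto
    then obtain a b where ab: "x = a + b" "a \<in> F" "b \<in> F"
      by (auto elim: set_plus_elim)
    moreover have "0 \<le> a" "0 \<le> b"
      using ab F(1) by auto
    ultimately show ?thesis
      using that by (auto intro!: set_plus_intro)
  qed
  then show ?thesis
    using F by (auto simp: bases_def)
qed

text \<open>A basis for \<open>k + 1\<close> is a basis for \<open>k\<close> together with the
  choice whether to include \<open>k + 1\<close>. This makes the density decreasing.\<close>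

lemma card_bases_Suc_le: "card (bases (Suc k)) \<le> 2 * card (bases k)"
proof -
  have "F \<in> bases k \<union> insert (int (Suc k)) ` bases k" if "F \<in> bases (Suc k)" for F
  proof -
    have "{0..int (Suc k)} = insert (int (Suc k)) {0..int k}"
      by auto
    then have "F \<subseteq> insert (int (Suc k)) {0..int k}"
      using that by (auto simp: bases_def)
    then have "F = F \<inter> {0..int k} \<or> F = insert (int (Suc k)) (F \<inter> {0..int k})"
      by blast
    then show ?thesis
      using bases_restrict[OF that] by (metis UnCI image_eqI)
  qed
  then have "card (bases (Suc k)) \<le> card (bases k \<union> insert (int (Suc k)) ` bases k)"
    by (intro card_mono) (auto simp: finite_bases)
  also have "\<dots> \<le> card (bases k) + card (insert (int (Suc k)) ` bases k)"
    by (rule card_Un_le)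
  also have "\<dots> \<le> 2 * card (bases k)"
    using card_image_le[OF finite_bases, of "insert (int (Suc k))" k] by simp
  finally show ?thesis .
qed

text \<open>For a uniformly random subset of \<open>U\<close>, the traces on disjoint blocks are
  independent, and each avoids its forbidden pattern with probability
  \<open>1 - 1 / 2 ^ card (D i)\<close>. The induction splits off one block, so \<open>U\<close>
  must vary.\<close>

lemma card_avoiding_patterns_le:
  fixes D E :: "'i \<Rightarrow> 'a set"
  assumes "finite I" "finite U" "disjoint_family_on D I"
    and "\<And>i. i \<in> I \<Longrightarrow> D i \<subseteq> U" "\<And>i. i \<in> I \<Longrightarrow> E i \<subseteq> D i"
  shows "real (card {F \<in> Pow U. \<forall>i\<in>I. F \<inter> D i \<noteq> E i})
    \<le> 2 ^ card U * (\<Prod>i\<in>I. 1 - 1 / 2 ^ card (D i))"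
  using assms
proof (induction I arbitrary: U rule: finite_induct)
  case empty
  then show ?case by (simp add: card_Pow flip: Pow_def)
next
  case (insert j I)
  let ?V = "U - D j"
  let ?X = "{F \<in> Pow U. \<forall>i\<in>insert j I. F \<inter> D i \<noteq> E i}"
  let ?Y = "{F \<in> Pow ?V. \<forall>i\<in>I. F \<inter> D i \<noteq> E i}"
  have disj: "D i \<inter> D j = {}" if "i \<in> I" for i
    using insert.prems(2) insert.hyps(2) that by (auto simp: disjoint_family_on_def)
  have fin: "finite (D j)" "finite ?V"
    using insert.prems by (auto intro: finite_subset)
  have IH: "real (card ?Y) \<le> 2 ^ card ?V * (\<Prod>i\<in>I. 1 - 1 / 2 ^ card (D i))"
  proof (rule insert.IH)
    show "D i \<subseteq> ?V" if "i \<in> I" for i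
      using insert.prems(3)[of i] disj[OF that] that by auto
    show "disjoint_family_on D I"
      using insert.prems(2) by (rule disjoint_family_on_mono[rotated]) auto
  qed (use insert.prems fin in auto)
  \<comment> \<open>A set is determined by its parts off and on the block \<open>D j\<close>; the
    second part has \<open>2 ^ card (D j) - 1\<close> permitted values.\<close>
  have "inj_on (\<lambda>F. (F \<inter> ?V, F \<inter> D j)) ?X"
    by (rule inj_onI) blast
  moreover have "(\<lambda>F. (F \<inter> ?V, F \<inter> D j)) ` ?X \<subseteq> ?Y \<times> (Pow (D j) - {E j})"
  proof (rule image_subsetI)
    fix F assume F: "F \<in> ?X"
    have "F \<inter> ?V \<inter> D i = F \<inter> D i" if "i \<in> I" for i
      using disj[OF that] F by blast
    then show "(F \<inter> ?V, F \<inter> D j) \<in> ?Y \<times> (Pow (D j) - {E j})"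
      using F by auto
  qed
  moreover have "finite ?Y"
    using fin by (intro finite_subset[of ?Y "Pow ?V"]) auto
  then have "finite (?Y \<times> (Pow (D j) - {E j}))"
    using fin by (intro finite_cartesian_product) auto
  ultimately have "card ?X \<le> card (?Y \<times> (Pow (D j) - {E j}))"
    by (rule card_inj_on_le)
  also have "\<dots> = card ?Y * (2 ^ card (D j) - 1)"
    using insert.prems(4)[of j] fin by (simp add: card_cartesian_product card_Pow)
  finally have "real (card ?X) \<le> real (card ?Y * (2 ^ card (D j) - 1))"
    by (rule of_nat_mono)
  also have "\<dots> = real (card ?Y) * (2 ^ card (D j) - 1)"
    by (simp add: of_nat_diff)
  also have "\<dots> \<le> (2 ^ card ?V * (\<Prod>i\<in>I. 1 - 1 / 2 ^ card (D i))) * (2 ^ card (D j) - 1)"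
    using IH by (intro mult_right_mono) auto
  also have "\<dots> = (2 ^ card ?V * 2 ^ card (D j)) *
      ((1 - 1 / 2 ^ card (D j)) * (\<Prod>i\<in>I. 1 - 1 / 2 ^ card (D i)))"
    by (simp add: field_simps)
  also have "(2::real) ^ card ?V * 2 ^ card (D j) = 2 ^ card U"
    using insert.prems(1,3) fin
    by (simp add: card_Diff_subset card_mono flip: power_add)
  finally show ?case
    using insert.hyps by simp
qed

lemma sum_three_quarters_div_2_le: "(\<Sum>i<n. (3/4 :: real) ^ (i div 2)) \<le> 8"
proof -
  \<comment> \<open>Every exponent occurs twice, giving twice a geometric sum; an arbitrary range is
    then padded to even length.\<close>
  have even: "(\<Sum>i<2 * m. (3/4 :: real) ^ (i div 2)) = 8 * (1 - (3/4) ^ m)" for m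
    by (induction m) (auto simp: algebra_simps)
  have "(\<Sum>i<n. (3/4 :: real) ^ (i div 2)) \<le> (\<Sum>i<2 * n. (3/4) ^ (i div 2))"
    by (rule sum_mono2) auto
  then show ?thesis
    unfolding even by (smt (verit) zero_le_power divide_nonneg_nonneg)
qed

text \<open>Conditionally on \<open>{0..3} \<subseteq> F\<close>, each \<open>a \<le> 3\<close> yields \<open>7 + i = a + (7 + i - a)\<close> with
  probability \<open>1/2\<close>, and each further \<open>a \<le> 3 + i div 2\<close> with probability \<open>1/4\<close>, independently.\<close>

lemma card_missing_sum_le:
  assumes "7 + i \<le> k"
  shows "real (card {F \<in> Pow {4..int k}. 7 + int i \<notin> ({0..3} \<union> F) + ({0..3} \<union> F)})
    \<le> 2 ^ (k - 3) * (1 / 16 * (3/4) ^ (i div 2))"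
proof -
  define x where "x = 7 + int i"
  \<comment> \<open>Exactly the \<open>a\<close> with \<open>2 * a < x\<close>, so each unordered
    pair of distinct nonnegative summands of \<open>x\<close> is counted once.\<close>
  define I where "I = {..<4 + i div 2}"
  \<comment> \<open>Elements up to \<open>3\<close> are always present and are dropped, leaving one
    random element for \<open>a < 4\<close> and two otherwise. Missing \<open>x\<close> means that
    no \<open>D a\<close> is contained in \<open>F\<close>.\<close>
  define D where "D a = {int a, x - int a} - {..3}" for a :: nat
  have less: "int a < x - int a" if "a \<in> I" for a
    using that by (auto simp: I_def x_def)
  have card_D: "card (D a) = (if a < 4 then 1 else 2)" if "a \<in> I" for a
  proof (cases "a < 4")
    case True
    then have "D a = {x - int a}"
      by (auto simp: D_def x_def)
    then show ?thesis using True by simp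
  next
    case False
    then have "D a = {int a, x - int a}"
      using less[OF that] by (auto simp: D_def)
    then show ?thesis using False less[OF that] by simp
  qed
  have "{F \<in> Pow {4..int k}. x \<notin> ({0..3} \<union> F) + ({0..3} \<union> F)}
      \<subseteq> {F \<in> Pow {4..int k}. \<forall>a\<in>I. F \<inter> D a \<noteq> D a}"
  proof safe
    fix F a
    assume a: "a \<in> I" and F: "F \<inter> D a = D a" and no: "x \<notin> ({0..3} \<union> F) + ({0..3} \<union> F)"
    have "int a \<in> {0..3} \<union> F" "x - int a \<in> {0..3} \<union> F"
      using F less[OF a] by (force simp: D_def)+
    from set_plus_intro[OF this] no show False by simp
  qed
  then have "card {F \<in> Pow {4..int k}. x \<notin> ({0..3} \<union> F) + ({0..3} \<union> F)}
      \<le> card {F \<in> Pow {4..int k}. \<forall>a\<in>I. F \<inter> D a \<noteq> D a}"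
    by (intro card_mono) auto
  also have "real \<dots> \<le> 2 ^ card {4..int k} * (\<Prod>a\<in>I. 1 - 1 / 2 ^ card (D a))"
  proof (rule card_avoiding_patterns_le)
    show "disjoint_family_on D I"
      unfolding disjoint_family_on_def
    proof (intro ballI impI)
      fix a b assume "a \<in> I" "b \<in> I" "a \<noteq> b"
      with less[of a] less[of b] show "D a \<inter> D b = {}"
        by (auto simp: D_def)
    qed
    show "D a \<subseteq> {4..int k}" if "a \<in> I" for a
      using less[OF that] assms by (auto simp: D_def x_def)
  qed (auto simp: I_def)
  also have "(\<Prod>a\<in>I. 1 - 1 / 2 ^ card (D a)) = (\<Prod>a\<in>I. if a < 4 then 1 / 2 else 3 / 4 :: real)"
    by (rule prod.cong) (auto simp: card_D)
  also have "\<dots> = 1 / 16 * (3/4) ^ (i div 2)"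
  proof -
    have "(\<Prod>a<4 + m. if a < 4 then 1 / 2 else 3 / 4 :: real) = 1 / 16 * (3/4) ^ m" for m
      by (induction m) (auto simp: eval_nat_numeral)
    then show ?thesis by (simp add: I_def)
  qed
  also have "card {4..int k} = k - 3"
    by simp
  finally show ?thesis by (simp add: x_def)
qed

text \<open>The failure probabilities sum to at most \<open>8 / 16 = 1/2\<close>, so at least half
  of the \<open>2 ^ (k - 3)\<close> sets containing \<open>{0..3}\<close> are bases.\<close>

lemma card_bases_ge:
  assumes "3 \<le> k"
  shows "2 ^ k / 16 \<le> real (card (bases k))"
proof -
  let ?P = "Pow {4..int k}"
  define Bad where "Bad i = {F \<in> ?P. 7 + int i \<notin> ({0..3} \<union> F) + ({0..3} \<union> F)}" for i
  have "finite (Bad i)" for i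
    by (simp add: Bad_def)
  \<comment> \<open>The set \<open>{0..3}\<close> alone already represents \<open>0\<close> to
    \<open>6\<close>, so failures can only start at \<open>7\<close>.\<close>
  have small: "x \<in> ({0..3} \<union> F) + ({0..3} \<union> F)" if "0 \<le> x" "x < 7" for x :: int and F
  proof -
    have "min x 3 + (x - min x 3) \<in> ({0..3} \<union> F) + ({0..3} \<union> F)"
      by (intro set_plus_intro) (use that in auto)
    then show ?thesis by simp
  qed
  \<comment> \<open>The indices \<open>i < k - 6\<close> run through the targets \<open>7\<close> to
    \<open>k\<close>; for \<open>k \<le> 6\<close> the truncated difference is \<open>0\<close> and
    there is no bad event.\<close>
  have "(\<union>) {0..3} ` (?P - (\<Union>i<k - 6. Bad i)) \<subseteq> bases k"
  proof (rule image_subsetI)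
    fix F assume F: "F \<in> ?P - (\<Union>i<k - 6. Bad i)"
    have "x \<in> ({0..3} \<union> F) + ({0..3} \<union> F)" if x: "x \<in> {0..int k}" for x
    proof (cases "x < 7")
      case False
      then have "nat (x - 7) < k - 6" "7 + int (nat (x - 7)) = x"
        using x by auto
      then show ?thesis
        using F by (fastforce simp: Bad_def)
    qed (use x small in auto)
    then show "{0..3} \<union> F \<in> bases k"
      using F assms by (auto simp: bases_def)
  qed
  moreover have "inj_on ((\<union>) {0..3}) (?P - (\<Union>i<k - 6. Bad i))"
  proof (rule inj_on_subset)
    show "inj_on ((\<union>) {0..3}) ?P"
    proof (rule inj_onI)
      fix F G :: "int set"
      assume "F \<in> ?P" "G \<in> ?P" "{0..3} \<union> F = {0..3} \<union> G"
      moreover have "F = ({0..3} \<union> F) - {0..3}" if "F \<in> ?P" for F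
        using that by auto
      ultimately show "F = G" by metis
    qed
  qed auto
  ultimately have "card (?P - (\<Union>i<k - 6. Bad i)) \<le> card (bases k)"
    by (intro card_inj_on_le finite_bases)
  moreover have "card ?P - card (\<Union>i<k - 6. Bad i) \<le> card (?P - (\<Union>i<k - 6. Bad i))"
    by (rule diff_card_le_card_Diff) (simp add: \<open>\<And>i. finite (Bad i)\<close>)
  ultimately have "card ?P \<le> card (bases k) + card (\<Union>i<k - 6. Bad i)"
    by linarith
  also have "\<dots> \<le> card (bases k) + (\<Sum>i<k - 6. card (Bad i))"
    by (intro add_left_mono card_UN_le) simp
  finally have "real (card ?P) \<le> real (card (bases k)) + (\<Sum>i<k - 6. real (card (Bad i)))"
    by (metis of_nat_add of_nat_mono of_nat_sum)
  moreover have "(\<Sum>i<k - 6. real (card (Bad i)))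
      \<le> (\<Sum>i<k - 6. 2 ^ (k - 3) * (1 / 16 * (3/4) ^ (i div 2)))"
    unfolding Bad_def by (intro sum_mono card_missing_sum_le) auto
  moreover have "\<dots> = 2 ^ (k - 3) / 16 * (\<Sum>i<k - 6. (3/4) ^ (i div 2))"
    by (simp add: sum_distrib_left)
  moreover have "\<dots> \<le> 2 ^ (k - 3) / 16 * 8"
    by (intro mult_left_mono sum_three_quarters_div_2_le) auto
  moreover have "real (card ?P) = 2 ^ (k - 3)"
    by (simp add: card_Pow)
  moreover have "(2::real) ^ k = 8 * 2 ^ (k - 3)"
    using assms power_add[of "2::real" 3 "k - 3"] by simp
  ultimately show ?thesis by linarith
qed

text \<open>Monotonicity gives the limit and the uniform bound \<open>1 / 16\<close> keeps it
  positive, which allows dividing by it to obtain the asymptotic equivalence.\<close>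

lemma bases_density_convergent:
  obtains L where "(\<lambda>k. real (card (bases k)) / 2 ^ k) \<longlonglongrightarrow> L" "0 < L"
proof -
  define c where "c = (\<lambda>k. real (card (bases k)) / 2 ^ k)"
  have "c (Suc k) \<le> c k" for k
    using card_bases_Suc_le[of k] by (simp add: c_def field_simps flip: of_nat_mult)
  then have "decseq c"
    by (rule decseq_SucI)
  then obtain L where L: "c \<longlonglongrightarrow> L"
    using decseq_convergent[of c 0] by (auto simp: c_def)
  have "eventually (\<lambda>k. 1 / 16 \<le> c k) sequentially"
    using eventually_ge_at_top[of 3]
  proof eventually_elim
    case (elim k)
    from card_bases_ge[OF this] show ?case
      by (simp add: c_def field_simps)
  qed
  with L have "1 / 16 \<le> L"
    by (intro tendsto_lowerbound) auto
  with L show ?thesis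
    by (intro that[of L]) (auto simp: c_def)
qed

theorem mainTheorem3:
  shows "(\<forall>k::nat. card (bases k) = A_sigma' (2 * int k + 1)) \<and>
         gamma_sigma \<longlonglongrightarrow> gamma_sigma_inf \<and>
         (\<lambda>k::nat. real (card (bases k))) \<sim>[at_top] (\<lambda>k. gamma_sigma_inf * 2 ^ k)"
proof -
  obtain L where L: "(\<lambda>k. real (card (bases k)) / 2 ^ k) \<longlonglongrightarrow> L" "0 < L"
    by (rule bases_density_convergent)
  have "filterlim (\<lambda>g::nat. (g - 1) div 2) at_top at_top"
    unfolding filterlim_at_top
  proof
    fix m :: nat
    show "\<forall>\<^sub>F g in at_top. m \<le> (g - 1) div 2"
      using eventually_ge_at_top[of "2 * m + 1"] by eventually_elim auto
  qed
  \<comment> \<open>The sequence \<open>gamma_sigma\<close> runs through the densities, each taken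
    at two consecutive \<open>g\<close>; the agreement starts at \<open>g = 1\<close>, where
    \<open>g - 1\<close> is not truncated.\<close>
  from filterlim_compose[OF L(1) this] have "gamma_sigma \<longlonglongrightarrow> L"
  proof (rule Lim_transform_eventually)
    show "\<forall>\<^sub>F g in sequentially. real (card (bases ((g - 1) div 2))) / 2 ^ ((g - 1) div 2)
        = gamma_sigma g"
      using eventually_ge_at_top[of 1] by eventually_elim (simp add: gamma_sigma_eq)
  qed
  then have inf: "gamma_sigma_inf = L" and lim: "gamma_sigma \<longlonglongrightarrow> gamma_sigma_inf"
    by (auto simp: gamma_sigma_inf_def limI)
  have "(\<lambda>k. real (card (bases k)) / 2 ^ k / L) \<longlonglongrightarrow> L / L"
    using L by (intro tendsto_divide) auto
  then have "(\<lambda>k. real (card (bases k)) / (L * 2 ^ k)) \<longlonglongrightarrow> 1"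
    using L(2) by (simp add: mult.commute)
  then have "(\<lambda>k::nat. real (card (bases k))) \<sim>[at_top] (\<lambda>k. gamma_sigma_inf * 2 ^ k)"
    unfolding inf by (rule asymp_equivI')
  with lim show ?thesis
    by (simp add: A_sigma'_eq_card_bases)
qed

end
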